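(* Let $X\subseteq l_{\infty}$ and let $\tau$ be any topology on $X$. Then the following assertions hold: (1) There exists an ethical social welfare order $\precsim$ on $X$ which satisfies anonymity and strong monotonicity, and which is $\tau$-continuous provided that $\tau$ is finer than the coarsest topology including $\tau^{\precsim}_{U}$ and $\tau^{\precsim}_{L}$. (2) There exists an ethical social welfare order $\precsim$ on $X$ which satisfies anonymity and strong monotonicity, and which is lower $\tau$-continuous provided that $\tau$ is finer than $\tau^{\precsim}_{U}$.
   Context: $l_{\infty}$ is the set of bounded real sequences $x=(x_n)_{n\in\mathbb{N}}$. A preorder is a reflexive transitive relation $\precsim$; $x\sim y$ means $x\precsim y$ and $y\precsim x$; $x\prec y$ means $x\precsim y$ and not $y\precsim x$. A finite permutation is a bijection $\pi:\mathbb{N}\to\mathbb{N}$ for which there is $t_0$ with $\pi(t)=t$ for all $t>t_0$; $\Pi_\infty$ is the set of all of them, and $\pi(x)=(x_{\pi(n)})_{n\in\mathbb{N}}$. Axioms for a preorder $\precsim$ on $X$ (comparisons concern elements of $X$). Anonymity: $x\sim\pi(x)$ for all $x\in X$ and $\pi\in\Pi_\infty$ (with $\pi(x)\in X$). Distributive fairness semiconvexity: for all $x\in X$, $\pi\in\Pi_\infty$ with $x\ne\pi(x)$ there is $s\in(0,1)$ with $x\prec sx+(1-s)\pi(x)$ and $\pi(x)\prec sx+(1-s)\pi(x)$. Sensitivity to the present: for each $x\in X$ there are $y,z\in X$ and $t\in\mathbb{N}$ such that $(z_1,\dots,z_t,x_{t+1},x_{t+2},\dots)\prec(y_1,\dots,y_t,x_{t+1},x_{t+2},\dots)$.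 Weak monotonicity: $x\prec y$ whenever $x,y\in X$ and $x_t<y_t$ for all $t$. Strong monotonicity: $x\prec y$ whenever $x,y\in X$, $x_t\le y_t$ for all $t$ and $x\neq y$. An ethical social welfare preorder on $X$ is a preorder satisfying an equity requirement (anonymity, distributive fairness semiconvexity or sensitivity to the present) and a monotonicity requirement (strong or weak). An ethical social welfare order is an ethical social welfare preorder that is complete (total). For $y\in X$ let $L^{\precsim}(y)=\{x\in X: x\precsim y\}$ and $U^{\precsim}(y)=\{x\in X: y\precsim x\}$. $\tau^{\precsim}_{U}$ (resp. $\tau^{\precsim}_{L}$) is the topology on $X$ generated by the subbase $\{X\setminus L^{\precsim}(x)\}_{x\in X}$ (resp. $\{X\setminus U^{\precsim}(x)\}_{x\in X}$). $\precsim$ is lower $\tau$-continuous if every $L^{\precsim}(y)$ is $\tau$-closed, and $\tau$-continuous if every $L^{\precsim}(y)$ and every $U^{\precsim}(y)$ is $\tau$-closed. "$\tau$ finer than $\tau'$" means $\tau'\subseteq\tau$. *)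

theory Defs
  imports "HOL-Analysis.Analysis"
begin

type_synonym rseq = "nat \<Rightarrow> real"

definition l_infty :: "rseq set" where
  "l_infty = {x. bounded (range x)}"

definition finite_permutations :: "(nat \<Rightarrow> nat) set" where
  "finite_permutations = {p. bij p \<and> (\<exists>t0. \<forall>t>t0. p t = t)}"

text \<open>
  A preorder on \<open>X\<close> is a relation \<open>R \<subseteq> X \<times> X\<close> with \<open>preorder_on X R\<close>; \<open>(x, y) \<in> R\<close> reads
  \<open>x \<precsim> y\<close>. The permuted sequence \<open>(x\<^bsub>p n\<^esub>)\<^bsub>n\<^esub>\<close> is \<open>x \<circ> p\<close>.
\<close>

definition indifferent :: "rseq rel \<Rightarrow> rseq \<Rightarrow> rseq \<Rightarrow> bool" where
  "indifferent R x y \<longleftrightarrow> (x, y) \<in> R \<and> (y, x) \<in> R"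

definition strictly_below :: "rseq rel \<Rightarrow> rseq \<Rightarrow> rseq \<Rightarrow> bool" where
  "strictly_below R x y \<longleftrightarrow> (x, y) \<in> R \<and> (y, x) \<notin> R"

text \<open>
  Since \<open>X\<close> need not be convex nor closed under permuting or splicing sequences, each axiom
  requires every sequence it compares to lie in \<open>X\<close>.
\<close>

definition anonymity :: "rseq set \<Rightarrow> rseq rel \<Rightarrow> bool" where
  "anonymity X R \<longleftrightarrow>
    (\<forall>x\<in>X. \<forall>p\<in>finite_permutations. x \<circ> p \<in> X \<longrightarrow> indifferent R x (x \<circ> p))"

definition distributive_fairness_semiconvexity :: "rseq set \<Rightarrow> rseq rel \<Rightarrow> bool" where
  "distributive_fairness_semiconvexity X R \<longleftrightarrow>
    (\<forall>x\<in>X. \<forall>p\<in>finite_permutations. x \<circ> p \<in> X \<longrightarrow> x \<noteq> x \<circ> p \<longrightarrow>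
      (\<exists>s::real. 0 < s \<and> s < 1 \<and>
        (let m = (\<lambda>n. s * x n + (1 - s) * (x \<circ> p) n)
         in m \<in> X \<and> strictly_below R x m \<and> strictly_below R (x \<circ> p) m)))"

text \<open>
  Replaces the first \<open>t\<close> terms of \<open>x\<close> by those of \<open>y\<close>; sequences are indexed from \<open>0\<close>,
  so these are the terms at \<open>0, \<dots>, t - 1\<close>.
\<close>

definition splice_prefix :: "nat \<Rightarrow> rseq \<Rightarrow> rseq \<Rightarrow> rseq" where
  "splice_prefix t y x = (\<lambda>n. if n < t then y n else x n)"

definition sensitivity_to_present :: "rseq set \<Rightarrow> rseq rel \<Rightarrow> bool" where
  "sensitivity_to_present X R \<longleftrightarrow>
    (\<forall>x\<in>X. \<exists>y\<in>X. \<exists>z\<in>X. \<exists>t\<ge>1.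
      splice_prefix t z x \<in> X \<and> splice_prefix t y x \<in> X \<and>
      strictly_below R (splice_prefix t z x) (splice_prefix t y x))"

definition weak_monotonicity :: "rseq set \<Rightarrow> rseq rel \<Rightarrow> bool" where
  "weak_monotonicity X R \<longleftrightarrow>
    (\<forall>x\<in>X. \<forall>y\<in>X. (\<forall>t. x t < y t) \<longrightarrow> strictly_below R x y)"

definition strong_monotonicity :: "rseq set \<Rightarrow> rseq rel \<Rightarrow> bool" where
  "strong_monotonicity X R \<longleftrightarrow>
    (\<forall>x\<in>X. \<forall>y\<in>X. (\<forall>t. x t \<le> y t) \<and> x \<noteq> y \<longrightarrow> strictly_below R x y)"

definition ethical_social_welfare_preorder :: "rseq set \<Rightarrow> rseq rel \<Rightarrow> bool" where
  "ethical_social_welfare_preorder X R \<longleftrightarrow>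
    preorder_on X R \<and>
    (anonymity X R \<or> distributive_fairness_semiconvexity X R \<or> sensitivity_to_present X R) \<and>
    (strong_monotonicity X R \<or> weak_monotonicity X R)"

definition ethical_social_welfare_order :: "rseq set \<Rightarrow> rseq rel \<Rightarrow> bool" where
  "ethical_social_welfare_order X R \<longleftrightarrow> ethical_social_welfare_preorder X R \<and> total_on X R"

definition lower_contour :: "rseq set \<Rightarrow> rseq rel \<Rightarrow> rseq \<Rightarrow> rseq set" where
  "lower_contour X R y = {x\<in>X. (x, y) \<in> R}"

definition upper_contour :: "rseq set \<Rightarrow> rseq rel \<Rightarrow> rseq \<Rightarrow> rseq set" where
  "upper_contour X R y = {x\<in>X. (y, x) \<in> R}"

text \<open>
  The sets \<open>X - lower_contour X R x\<close> need not cover \<open>X\<close>, whereas \<open>topology_generated_by\<close> has the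
  union of its subbase as carrier. Inserting \<open>X\<close>, the empty intersection of subbasic sets,
  makes this a topology on \<open>X\<close>.
\<close>

definition upper_topology :: "rseq set \<Rightarrow> rseq rel \<Rightarrow> rseq topology" where
  "upper_topology X R =
    topology_generated_by (insert X ((\<lambda>x. X - lower_contour X R x) ` X))"

definition lower_topology :: "rseq set \<Rightarrow> rseq rel \<Rightarrow> rseq topology" where
  "lower_topology X R =
    topology_generated_by (insert X ((\<lambda>x. X - upper_contour X R x) ` X))"

definition coarsest_including :: "'a topology \<Rightarrow> 'a topology \<Rightarrow> 'a topology" where
  "coarsest_including S T = topology_generated_by ({U. openin S U} \<union> {U. openin T U})"

definition finer_than :: "'a topology \<Rightarrow> 'a topology \<Rightarrow> bool" where
  "finer_than T S \<longleftrightarrow> (\<forall>U. openin S U \<longrightarrow> openin T U)"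

definition lower_continuous :: "rseq set \<Rightarrow> rseq topology \<Rightarrow> rseq rel \<Rightarrow> bool" where
  "lower_continuous X T R \<longleftrightarrow> (\<forall>y\<in>X. closedin T (lower_contour X R y))"

definition order_continuous :: "rseq set \<Rightarrow> rseq topology \<Rightarrow> rseq rel \<Rightarrow> bool" where
  "order_continuous X T R \<longleftrightarrow>
    (\<forall>y\<in>X. closedin T (lower_contour X R y) \<and> closedin T (upper_contour X R y))"

end

theory Submission
  imports Defs "HOL-Combinatorics.Permutations"
begin

text \<open>
  Fix a free ultrafilter on the natural numbers and compare two sequences by comparing their
  partial sums along it. The ultrafilter makes this order total. A finite permutation changes
  only finitely many partial sums, and raising a coordinate raises all but finitely many of
  them strictly; freeness makes these finite sets of exceptions negligible. Continuity is immediate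
  from the way the topologies are generated.
\<close>

text \<open>In the order on filters a smaller filter has more eventual properties, so an ultrafilter
  is a minimal filter other than \<open>bot\<close>. Zorn's lemma is therefore applied to the
  reversed order, among the proper filters below \<open>F\<close>.\<close>

lemma ultrafilter_exists:
  fixes F :: "'a filter"
  assumes "F \<noteq> bot"
  obtains G where "G \<le> F" "G \<noteq> bot"
    "\<And>P. eventually P G \<or> eventually (\<lambda>x. \<not> P x) G"
proof -
  have "\<exists>G\<in>{G. G \<noteq> bot \<and> G \<le> F}. \<forall>H\<in>{G. G \<noteq> bot \<and> G \<le> F}. H \<le> G \<longrightarrow> H = G"
  proof (rule predicate_Zorn[where P = "\<lambda>G H. H \<le> G"])
    show "partial_order_on {G. G \<noteq> bot \<and> G \<le> F} (relation_of (\<lambda>G H. H \<le> G) {G. G \<noteq> bot \<and> G \<le> F})"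
      by (rule partial_order_on_relation_ofI) auto
  next
    fix C assume "C \<in> Chains (relation_of (\<lambda>G H. H \<le> G) {G. G \<noteq> bot \<and> G \<le> F})"
    then have C: "\<And>G. G \<in> C \<Longrightarrow> G \<noteq> bot \<and> G \<le> F"
      and chain: "\<And>G H. G \<in> C \<Longrightarrow> H \<in> C \<Longrightarrow> G \<le> H \<or> H \<le> G"
      unfolding Chains_def relation_of_def by blast+
    show "\<exists>U\<in>{G. G \<noteq> bot \<and> G \<le> F}. \<forall>G\<in>C. U \<le> G"
    proof (cases "C = {}")
      case True
      then show ?thesis using assms by auto
    next
      case False
      \<comment> \<open>Along a nonempty chain the infimum is just the union of the filters. Hence
        \<open>False\<close> is eventual in \<open>Inf C\<close> only if it is so in some member,
        and all members are proper.\<close>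
      have "eventually P (Inf C) \<longleftrightarrow> (\<exists>G\<in>C. eventually P G)" for P
        using False chain by (intro eventually_Inf_base) (auto simp: inf_absorb1 inf_absorb2)
      then have "Inf C \<noteq> bot"
        using C by (auto simp: trivial_limit_def)
      moreover have "Inf C \<le> F"
        using False C by (blast intro: Inf_lower2)
      ultimately show ?thesis by (auto intro: Inf_lower)
    qed
  qed
  then obtain G where G: "G \<noteq> bot" "G \<le> F"
    and max: "\<And>H. H \<noteq> bot \<Longrightarrow> H \<le> F \<Longrightarrow> H \<le> G \<Longrightarrow> H = G"
    by blast
  \<comment> \<open>Force \<open>P\<close> by meeting \<open>G\<close> with the principal filter of
    \<open>P\<close>. If the meet is trivial, then the negation of \<open>P\<close> already holds
    eventually in \<open>G\<close>; otherwise minimality says that the meet is \<open>G\<close>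
    itself.\<close>
  have "eventually P G \<or> eventually (\<lambda>x. \<not> P x) G" for P
  proof (cases "inf G (principal {x. P x}) = bot")
    case True
    then show ?thesis
      by (simp add: trivial_limit_def eventually_inf_principal)
  next
    case False
    then have "inf G (principal {x. P x}) = G"
      using G by (intro max) (auto intro: le_infI1)
    moreover have "eventually P (inf G (principal {x. P x}))"
      by (simp add: eventually_inf_principal)
    ultimately show ?thesis by simp
  qed
  with G show thesis using that by blast
qed

text \<open>For an ultrafilter \<open>F\<close> this compares the classes of the partial-sum
  sequences in the ultrapower of the reals along \<open>F\<close>.\<close>

definition partial_sum_order :: "nat filter \<Rightarrow> rseq set \<Rightarrow> rseq rel" where
  "partial_sum_order F X =
    {(x, y). x \<in> X \<and> y \<in> X \<and> (\<forall>\<^sub>F n in F. sum x {..<n} \<le> sum y {..<n})}"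

lemma preorder_on_partial_sum_order: "preorder_on X (partial_sum_order F X)"
  unfolding preorder_on_def refl_on_def
proof (intro conjI)
  show "trans (partial_sum_order F X)"
  proof (rule transI)
    fix x y z
    assume "(x, y) \<in> partial_sum_order F X" "(y, z) \<in> partial_sum_order F X"
    then have "\<forall>\<^sub>F n in F. sum x {..<n} \<le> sum y {..<n}" "\<forall>\<^sub>F n in F. sum y {..<n} \<le> sum z {..<n}"
      "x \<in> X" "z \<in> X"
      by (auto simp: partial_sum_order_def)
    then show "(x, z) \<in> partial_sum_order F X"
      by (auto simp: partial_sum_order_def elim: eventually_elim2)
  qed
qed (auto simp: partial_sum_order_def)

lemma total_on_partial_sum_order:
  assumes "\<And>P. eventually P F \<or> eventually (\<lambda>n. \<not> P n) F"
  shows "total_on X (partial_sum_order F X)"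
proof (rule total_onI)
  fix x y assume "x \<in> X" "y \<in> X"
  moreover have "(\<forall>\<^sub>F n in F. sum x {..<n} \<le> sum y {..<n}) \<or>
      (\<forall>\<^sub>F n in F. sum y {..<n} \<le> sum x {..<n})"
    using assms[of "\<lambda>n. sum x {..<n} \<le> sum y {..<n}"]
    by (metis (mono_tags, lifting) eventually_mono linear)
  ultimately show "(x, y) \<in> partial_sum_order F X \<or> (y, x) \<in> partial_sum_order F X"
    by (auto simp: partial_sum_order_def)
qed

lemma anonymity_partial_sum_order:
  assumes "F \<le> sequentially"
  shows "anonymity X (partial_sum_order F X)"
  unfolding anonymity_def
proof (intro ballI impI)
  fix x p assume x: "x \<in> X" "x \<circ> p \<in> X" and "p \<in> finite_permutations"
  then obtain t0 where p: "bij p" "\<And>t. t > t0 \<Longrightarrow> p t = t"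
    by (auto simp: finite_permutations_def)
  \<comment> \<open>From \<open>Suc t0\<close> on, \<open>{..<n}\<close> contains every index up to
    \<open>t0\<close>, so the bijection \<open>p\<close> fixes all points outside it and only
    rearranges the terms of the sum.\<close>
  have "sum (x \<circ> p) {..<n} = sum x {..<n}" if "n \<ge> Suc t0" for n
  proof -
    have "p permutes {..<n}"
      using p that unfolding permutes_def by (auto simp: bij_iff)
    then show ?thesis by (rule sum.permute[symmetric])
  qed
  then have "\<forall>\<^sub>F n in F. sum (x \<circ> p) {..<n} = sum x {..<n}"
    by (intro filter_leD[OF assms] eventually_sequentiallyI)
  then show "indifferent (partial_sum_order F X) x (x \<circ> p)"
    using x by (auto simp: indifferent_def partial_sum_order_def elim: eventually_mono)
qed

lemma strong_monotonicity_partial_sum_order: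
  assumes "F \<le> sequentially" "F \<noteq> bot"
  shows "strong_monotonicity X (partial_sum_order F X)"
  unfolding strong_monotonicity_def
proof (intro ballI impI)
  fix x y assume "x \<in> X" "y \<in> X" and xy: "(\<forall>t. x t \<le> y t) \<and> x \<noteq> y"
  then obtain k where "x k \<noteq> y k"
    by blast
  with xy have "x k < y k"
    by (simp add: order.strict_iff_order)
  \<comment> \<open>The index \<open>k\<close> belongs to \<open>{..<n}\<close> exactly from
    \<open>n = Suc k\<close> on.\<close>
  then have "sum x {..<n} < sum y {..<n}" if "n \<ge> Suc k" for n
    using xy that by (intro sum_strict_mono_ex1) auto
  then have less: "\<forall>\<^sub>F n in F. sum x {..<n} < sum y {..<n}"
    by (intro filter_leD[OF assms(1)] eventually_sequentiallyI)
  \<comment> \<open>Strictness is where properness of \<open>F\<close> enters: two opposite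
    inequalities that both hold eventually would make \<open>False\<close> eventual.\<close>
  have "\<not> (\<forall>\<^sub>F n in F. sum y {..<n} \<le> sum x {..<n})"
  proof
    assume "\<forall>\<^sub>F n in F. sum y {..<n} \<le> sum x {..<n}"
    with less have "\<forall>\<^sub>F n in F. False"
      by eventually_elim simp
    with assms(2) show False
      by (simp add: trivial_limit_def)
  qed
  with less \<open>x \<in> X\<close> \<open>y \<in> X\<close> show "strictly_below (partial_sum_order F X) x y"
    by (auto simp: strictly_below_def partial_sum_order_def elim: eventually_mono)
qed

text \<open>The complement of the contour set in \<open>X\<close>, which is the carrier of
  \<open>T\<close>, is a subbasic open set of the upper topology.\<close>

lemma closedin_lower_contour:
  assumes "topspace T = X" "finer_than T (upper_topology X R)" "y \<in> X"
  shows "closedin T (lower_contour X R y)"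
proof -
  have "openin (upper_topology X R) (X - lower_contour X R y)"
    unfolding upper_topology_def using assms(3) by (intro topology_generated_by_Basis) auto
  then show ?thesis
    using assms(1,2) by (auto simp: closedin_def finer_than_def lower_contour_def)
qed

lemma closedin_upper_contour:
  assumes "topspace T = X" "finer_than T (lower_topology X R)" "y \<in> X"
  shows "closedin T (upper_contour X R y)"
proof -
  have "openin (lower_topology X R) (X - upper_contour X R y)"
    unfolding lower_topology_def using assms(3) by (intro topology_generated_by_Basis) auto
  then show ?thesis
    using assms(1,2) by (auto simp: closedin_def finer_than_def upper_contour_def)
qed

lemma finer_than_coarsest_including:
  assumes "finer_than T (coarsest_including S S')"
  shows "finer_than T S" "finer_than T S'"
  using assms unfolding finer_than_def coarsest_including_def
  by (auto intro!: topology_generated_by_Basis)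

theorem theorem11:
  fixes X :: "(nat \<Rightarrow> real) set" and T :: "(nat \<Rightarrow> real) topology"
  assumes "X \<subseteq> l_infty" and "topspace T = X"
  shows "(\<exists>R. ethical_social_welfare_order X R \<and> anonymity X R \<and> strong_monotonicity X R \<and>
            (finer_than T (coarsest_including (upper_topology X R) (lower_topology X R)) \<longrightarrow>
              order_continuous X T R)) \<and>
         (\<exists>R. ethical_social_welfare_order X R \<and> anonymity X R \<and> strong_monotonicity X R \<and>
            (finer_than T (upper_topology X R) \<longrightarrow> lower_continuous X T R))"
proof -
  obtain F :: "nat filter" where F: "F \<le> sequentially" "F \<noteq> bot"
    and ultra: "\<And>P. eventually P F \<or> eventually (\<lambda>n. \<not> P n) F"
    using ultrafilter_exists[OF sequentially_bot] by blast
  \<comment> \<open>This order is built without reference to \<open>T\<close>, and it serves as the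
    witness for both assertions.\<close>
  define R where "R = partial_sum_order F X"
  have R: "anonymity X R" "strong_monotonicity X R"
    using F by (simp_all add: R_def anonymity_partial_sum_order strong_monotonicity_partial_sum_order)
  moreover have "ethical_social_welfare_order X R"
    using R ultra preorder_on_partial_sum_order total_on_partial_sum_order
    by (auto simp: ethical_social_welfare_order_def ethical_social_welfare_preorder_def R_def)
  moreover have "lower_continuous X T R" if "finer_than T (upper_topology X R)"
    using that assms(2) by (simp add: lower_continuous_def closedin_lower_contour)
  moreover have "order_continuous X T R"
    if "finer_than T (coarsest_including (upper_topology X R) (lower_topology X R))"
    using finer_than_coarsest_including[OF that] assms(2)
    by (simp add: order_continuous_def closedin_lower_contour closedin_upper_contour)
  ultimately show ?thesis by blast
qed

end
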